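(* For each pca $\mathcal{A}$ let $Eq$ be the function on $\mathcal{A}$ deciding equality: $Eq([a,b])=\mathsf{T}$ if $a=b$ and $\mathsf{F}$ otherwise. There is no decidable applicative morphism from any of the pcas $\mathcal{P}(\mathbb{N})[Eq]$, $\mathcal{K}_2[Eq]$, $2^\omega[Eq]$ into any of the pcas $\mathcal{P}(\mathbb{N})$, $\mathcal{K}_2$, $2^\omega$.
   Context: A partial combinatory algebra (pca) is a set $\mathcal{A}$ with a partial binary application $(a,b)\mapsto ab$ (associating to the left) such that there are $\mathsf{k},\mathsf{s}\in\mathcal{A}$ with, for all $a,b,c$: $\mathsf{k}ab=a$; $\mathsf{s}ab$ is defined; and whenever $(ac)(bc)$ is defined, $\mathsf{s}abc$ is defined and equals $(ac)(bc)$. Every pca contains booleans $\mathsf{T},\mathsf{F}$ with a definition-by-cases element $D$ ($D\mathsf{T}ab=a$, $D\mathsf{F}ab=b$), and standard codings $[a,b]$ of pairs and $[a_0,\ldots,a_{n-1}]$ of finite sequences whose basic operations (length, projections, appending) are representable by elements of the pca; fix such choices. For a pca $\mathcal{A}$ and a partial function $f:\mathcal{A}\to\mathcal{A}$, $\mathcal{A}[f]$ is the pca with underlying set $\mathcal{A}$ and application $\cdot_f$ defined by: $a\cdot_f b=c$ iff there is a finite sequence $e_0,\ldots,e_{n-1}$ in $\mathcal{A}$ (on each of which $f$ is defined) such that $a[b,f(e_0),\ldots,f(e_{i-1})]=[\mathsf{F},e_i]$ for all $i<n$ and $a[b,f(e_0),\ldots,f(e_{n-1})]=[\mathsf{T},c]$.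 (The function $f$ is representable in $\mathcal{A}[f]$, and so is the application of $\mathcal{A}$.) An applicative morphism $\gamma:\mathcal{A}\to\mathcal{B}$ assigns to every $a\in\mathcal{A}$ a nonempty subset $\gamma(a)\subseteq\mathcal{B}$ such that there is $r\in\mathcal{B}$ with: whenever $aa'$ is defined, $b\in\gamma(a)$, $b'\in\gamma(a')$, then $rbb'$ is defined and lies in $\gamma(aa')$. It is decidable if there is $d\in\mathcal{B}$ with $db=\mathsf{T}_{\mathcal{B}}$ for all $b\in\gamma(\mathsf{T}_{\mathcal{A}})$ and $dc=\mathsf{F}_{\mathcal{B}}$ for all $c\in\gamma(\mathsf{F}_{\mathcal{A}})$. The pcas: $[\cdot,\cdot]$ on $\mathbb{N}$ is a standard bijective pairing and $[\cdot,\ldots,\cdot]$ a standard coding of finite sequences of naturals. - $\mathcal{P}(\mathbb{N})$ (Scott's graph model): subsets of $\mathbb{N}$ with $A\circ B=\{n\mid\exists m\,([m,n]\in A,\ e_m\subseteq B)\}$, where $e_k$ is the finite set $p$ with $k=\sum_{i\in p}2^i$. - $\mathcal{K}_2$: set $\mathbb{N}^{\mathbb{N}}$; $\alpha\beta$ is defined iff for every $n$ there is $k$ with $\alpha([n,\beta(0),\ldots,\beta(k-1)])>0$, and then $(\alpha\beta)(n)=\alpha([n,\beta(0),\ldots,\beta(k-1)])-1$ for the least such $k$. - $2^\omega$: set $\{0,1\}^{\mathbb{N}}$; $\alpha\cdot\beta$ is defined iff for every $n$ there is $k$ with $\alpha([n,\beta(0),\ldots,\beta(k-1)])=1$, and then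 $(\alpha\cdot\beta)(n)=\alpha([n,\beta(0),\ldots,\beta(k)])$ for the least such $k$. *)

theory Defs
  imports Main "HOL-Library.Nat_Bijection"
begin

section \<open>Partial combinatory algebras\<close>

text \<open>The underlying set of a pca is a type; the partial application returns \<^term>\<open>None\<close>
  where it is undefined.\<close>

type_synonym 'a papp = "'a \<Rightarrow> 'a \<Rightarrow> 'a option"

text \<open>\<open>apps app a [b\<^sub>1, \<dots>, b\<^sub>n]\<close> is the left-associated application \<open>a b\<^sub>1 \<dots> b\<^sub>n\<close>.\<close>

fun apps :: "'a papp \<Rightarrow> 'a \<Rightarrow> 'a list \<Rightarrow> 'a option" where
  "apps app a [] = Some a"
| "apps app a (b # bs) = Option.bind (app a b) (\<lambda>c. apps app c bs)"

text \<open>The notions below are defined for an arbitrary application, so that they can be stated for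
  concrete applications without assuming that these are pcas.\<close>

definition pca :: "'a papp \<Rightarrow> bool" where
  "pca app \<longleftrightarrow> (\<exists>k s. \<forall>a b c.
     apps app k [a, b] = Some a \<and>
     apps app s [a, b] \<noteq> None \<and>
     (\<forall>u v w. app a c = Some u \<longrightarrow> app b c = Some v \<longrightarrow> app u v = Some w \<longrightarrow>
        apps app s [a, b, c] = Some w))"

subsection \<open>Booleans and codings\<close>

definition booleans :: "'a papp \<Rightarrow> 'a \<Rightarrow> 'a \<Rightarrow> bool" where
  "booleans app t f \<longleftrightarrow> (\<exists>D. \<forall>a b.
     apps app D [t, a, b] = Some a \<and> apps app D [f, a, b] = Some b)"

text \<open>The choices made once and for all in a pca. Numerals are included because the length of
  a coded sequence, and the index of a projection, are elements of the pca.\<close>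

record 'a coding =
  tt :: 'a
  ff :: 'a
  pair :: "'a \<Rightarrow> 'a \<Rightarrow> 'a"
  num :: "nat \<Rightarrow> 'a"
  seq :: "'a list \<Rightarrow> 'a"

text \<open>Injectivity of the codings is not required separately: it follows from the representability
  of the projections and of the length. The choice \<open>pair a b = seq [a, b]\<close> is allowed.\<close>

definition is_coding :: "'a papp \<Rightarrow> 'a coding \<Rightarrow> bool" where
  "is_coding app C \<longleftrightarrow>
     booleans app (tt C) (ff C) \<and>
     (\<exists>p p0 p1. \<forall>a b.
        apps app p [a, b] = Some (pair C a b) \<and>
        app p0 (pair C a b) = Some a \<and>
        app p1 (pair C a b) = Some b) \<and>
     (\<exists>succ pred zero. \<forall>n.
        app succ (num C n) = Some (num C (Suc n)) \<and>
        app pred (num C (Suc n)) = Some (num C n) \<and>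
        app zero (num C 0) = Some (tt C) \<and>
        app zero (num C (Suc n)) = Some (ff C)) \<and>
     (\<exists>len proj snoc. \<forall>as.
        app len (seq C as) = Some (num C (length as)) \<and>
        (\<forall>i < length as. apps app proj [num C i, seq C as] = Some (as ! i)) \<and>
        (\<forall>a. apps app snoc [seq C as, a] = Some (seq C (as @ [a]))))"

subsection \<open>Adjoining a partial function\<close>

text \<open>Here \<open>es\<close> is the list of queries \<open>e\<^sub>0, \<dots>, e\<^sub>n\<^sub>-\<^sub>1\<close> and \<open>vs\<close> the list of answers
  \<open>f(e\<^sub>0), \<dots>, f(e\<^sub>n\<^sub>-\<^sub>1)\<close>.\<close>

definition computes :: "'a papp \<Rightarrow> 'a coding \<Rightarrow> ('a \<Rightarrow> 'a option) \<Rightarrow> 'a \<Rightarrow> 'a \<Rightarrow> 'a \<Rightarrow> bool" where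
  "computes app C f a b c \<longleftrightarrow> (\<exists>es vs. length vs = length es \<and>
     (\<forall>i < length es. f (es ! i) = Some (vs ! i)) \<and>
     (\<forall>i < length es. app a (seq C (b # take i vs)) = Some (pair C (ff C) (es ! i))) \<and>
     app a (seq C (b # vs)) = Some (pair C (tt C) c))"

text \<open>For a valid coding of a nontrivial pca there is at most one \<open>c\<close> with
  \<^term>\<open>computes app C f a b c\<close>.\<close>

definition adjoin :: "'a papp \<Rightarrow> 'a coding \<Rightarrow> ('a \<Rightarrow> 'a option) \<Rightarrow> 'a papp" where
  "adjoin app C f a b =
     (if \<exists>c. computes app C f a b c then Some (THE c. computes app C f a b c) else None)"

text \<open>The partial function deciding equality; its domain is the set of coded pairs.\<close>

definition Eq_fun :: "'a coding \<Rightarrow> 'a \<Rightarrow> 'a option" where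
  "Eq_fun C x =
     (if \<exists>a. x = pair C a a then Some (tt C)
      else if \<exists>a b. a \<noteq> b \<and> x = pair C a b then Some (ff C)
      else None)"

definition adjoin_Eq :: "'a papp \<Rightarrow> 'a coding \<Rightarrow> 'a papp" where
  "adjoin_Eq app C = adjoin app C (Eq_fun C)"

subsection \<open>Applicative morphisms\<close>

definition applicative_morphism :: "'a papp \<Rightarrow> 'b papp \<Rightarrow> ('a \<Rightarrow> 'b set) \<Rightarrow> bool" where
  "applicative_morphism appA appB \<gamma> \<longleftrightarrow>
     (\<forall>a. \<gamma> a \<noteq> {}) \<and>
     (\<exists>r. \<forall>a a' c. appA a a' = Some c \<longrightarrow>
        (\<forall>b \<in> \<gamma> a. \<forall>b' \<in> \<gamma> a'. \<exists>d. apps appB r [b, b'] = Some d \<and> d \<in> \<gamma> c))"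

text \<open>The pairs are the booleans (true, false) of the source and of the target.\<close>

definition decidable_morphism :: "'a \<times> 'a \<Rightarrow> 'b papp \<Rightarrow> 'b \<times> 'b \<Rightarrow> ('a \<Rightarrow> 'b set) \<Rightarrow> bool" where
  "decidable_morphism bA appB bB \<gamma> \<longleftrightarrow> (\<exists>d.
     (\<forall>b \<in> \<gamma> (fst bA). appB d b = Some (fst bB)) \<and>
     (\<forall>c \<in> \<gamma> (snd bA). appB d c = Some (snd bB)))"

definition decidable_applicative_morphism ::
  "'a papp \<Rightarrow> 'a \<times> 'a \<Rightarrow> 'b papp \<Rightarrow> 'b \<times> 'b \<Rightarrow> ('a \<Rightarrow> 'b set) \<Rightarrow> bool" where
  "decidable_applicative_morphism appA bA appB bB \<gamma> \<longleftrightarrow>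
     applicative_morphism appA appB \<gamma> \<and> decidable_morphism bA appB bB \<gamma>"

section \<open>The three pcas\<close>

text \<open>Scott's graph model; \<^term>\<open>set_decode m\<close> is the finite set \<open>p\<close> with \<open>m = (\<Sum>i\<in>p. 2 ^ i)\<close>.\<close>

definition graph_app :: "nat set papp" where
  "graph_app A B = Some {n. \<exists>m. prod_encode (m, n) \<in> A \<and> set_decode m \<subseteq> B}"

text \<open>Code of \<open>[n, \<beta>(0), \<dots>, \<beta>(k-1)]\<close>.\<close>

definition query :: "nat \<Rightarrow> (nat \<Rightarrow> nat) \<Rightarrow> nat \<Rightarrow> nat" where
  "query n \<beta> k = list_encode (n # map \<beta> [0..<k])"

definition K2_app :: "(nat \<Rightarrow> nat) papp" where
  "K2_app \<alpha> \<beta> =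
     (if \<forall>n. \<exists>k. \<alpha> (query n \<beta> k) > 0
      then Some (\<lambda>n. \<alpha> (query n \<beta> (LEAST k. \<alpha> (query n \<beta> k) > 0)) - 1)
      else None)"

text \<open>Elements of \<open>2\<^sup>\<omega>\<close> are functions \<^typ>\<open>nat \<Rightarrow> bool\<close>, with \<^term>\<open>True\<close> for \<open>1\<close>. The output is read
  one position after the first \<open>1\<close>.\<close>

definition cantor_query :: "nat \<Rightarrow> (nat \<Rightarrow> bool) \<Rightarrow> nat \<Rightarrow> nat" where
  "cantor_query n \<beta> k = query n (\<lambda>i. of_bool (\<beta> i)) k"

definition cantor_app :: "(nat \<Rightarrow> bool) papp" where
  "cantor_app \<alpha> \<beta> =
     (if \<forall>n. \<exists>k. \<alpha> (cantor_query n \<beta> k)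
      then Some (\<lambda>n. \<alpha> (cantor_query n \<beta> (Suc (LEAST k. \<alpha> (cantor_query n \<beta> k)))))
      else None)"

end

theory Submission
  imports Defs "HOL-Library.Countable_Set"
begin

text \<open>In each of the three pcas the underlying set carries a second countable topology for which
  application is continuous, and every partial continuous function is represented by an element.
  Hence for every \<open>a\<close> the source contains \<open>q\<^sub>a\<close> with \<open>q\<^sub>a \<cdot> b\<close> true iff \<open>a = b\<close>.
  Choosing \<open>y\<^sub>a \<in> \<gamma>(q\<^sub>a)\<close> and \<open>x\<^sub>a \<in> \<gamma>(a)\<close>, a decidable morphism would give a continuous
  partial function sending \<open>(y\<^sub>a, x\<^sub>b)\<close> to true iff \<open>a = b\<close>. A basic neighbourhood of
  \<open>(y\<^sub>a, x\<^sub>a)\<close> on which the value stays true determines \<open>a\<close>, so the source would be countable.\<close>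

section \<open>Continuous applications\<close>

text \<open>Continuity on the domain of \<open>f\<close> with its subspace topology, the
  \<open>N k\<close> being the basic open sets. The domain itself may be any set.\<close>

definition pcontinuous :: "('i \<Rightarrow> 'a set) \<Rightarrow> ('a \<Rightarrow> 'a option) \<Rightarrow> bool" where
  "pcontinuous N f \<longleftrightarrow> (\<forall>x y k. f x = Some y \<longrightarrow> y \<in> N k \<longrightarrow>
     (\<exists>i. x \<in> N i \<and> (\<forall>x' \<in> N i. \<forall>y'. f x' = Some y' \<longrightarrow> y' \<in> N k)))"

lemma pcontinuousD:
  assumes "pcontinuous N f" "f x = Some y" "y \<in> N k"
  obtains i where "x \<in> N i" "\<And>x' y'. x' \<in> N i \<Longrightarrow> f x' = Some y' \<Longrightarrow> y' \<in> N k"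
  using assms unfolding pcontinuous_def by meson

lemma is_codingE:
  assumes "is_coding app C"
  obtains D p "pred" zero len proj where "\<And>a b. apps app D [tt C, a, b] = Some a"
      "\<And>a b. apps app D [ff C, a, b] = Some b"
      "\<And>a b. apps app p [a, b] = Some (pair C a b)"
      "\<And>n. app pred (num C (Suc n)) = Some (num C n)"
      "app zero (num C 0) = Some (tt C)" "\<And>n. app zero (num C (Suc n)) = Some (ff C)"
      "\<And>as. app len (seq C as) = Some (num C (length as))"
      "\<And>as i. i < length as \<Longrightarrow> apps app proj [num C i, seq C as] = Some (as ! i)"
  using assms unfolding is_coding_def booleans_def
  apply (elim conjE exE)
  subgoal for D p "succ" len p0 "pred" proj p1 zero snoc
    by (rule that[of D p "pred" zero len proj]) (simp_all del: apps.simps)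
  done

text \<open>Common interface of the three models: a countable base, application continuous where it
  is defined, and every partial continuous map extended by the action of some element. The
  representability condition does the work of \<open>k\<close> and \<open>s\<close>. The condition
  \<open>separated\<close> says that the topology is not indiscrete, which fits the Scott topology
  as well as the Hausdorff sequence spaces.\<close>

locale continuous_papp =
  fixes app :: "'a papp" and N :: "'i::countable \<Rightarrow> 'a set"
  assumes basis_cover: "\<And>x. \<exists>i. x \<in> N i"
    and basis_inter: "\<And>x i j. x \<in> N i \<Longrightarrow> x \<in> N j \<Longrightarrow> \<exists>k. x \<in> N k \<and> N k \<subseteq> N i \<inter> N j"
    and app_continuous: "\<And>a b c k. app a b = Some c \<Longrightarrow> c \<in> N k \<Longrightarrow>
      \<exists>i j. a \<in> N i \<and> b \<in> N j \<and>
        (\<forall>a' \<in> N i. \<forall>b' \<in> N j. \<forall>c'. app a' b' = Some c' \<longrightarrow> c' \<in> N k)"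
    and representable: "\<And>f. pcontinuous N f \<Longrightarrow> \<exists>e. \<forall>x y. f x = Some y \<longrightarrow> app e x = Some y"
    and separated: "\<exists>x y k. x \<in> N k \<and> y \<notin> N k"
begin

lemma pcontinuous_id: "pcontinuous N Some"
  unfolding pcontinuous_def by auto

lemma pcontinuous_const: "pcontinuous N (\<lambda>_. Some c)"
  unfolding pcontinuous_def using basis_cover by auto

lemma app_continuousE:
  assumes "app a b = Some c" "c \<in> N k"
  obtains i j where "a \<in> N i" "b \<in> N j"
    "\<And>a' b' c'. a' \<in> N i \<Longrightarrow> b' \<in> N j \<Longrightarrow> app a' b' = Some c' \<Longrightarrow> c' \<in> N k"
  using app_continuous[OF assms] by blast

text \<open>Together with constants and the identity, this makes every applicative term in one
  variable continuous, hence representable; it takes the place of combinatory completeness.\<close>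

lemma pcontinuous_app:
  assumes f: "pcontinuous N f" and g: "pcontinuous N g"
  shows "pcontinuous N (\<lambda>s. Option.bind (f s) (\<lambda>u. Option.bind (g s) (app u)))"
  unfolding pcontinuous_def
proof (intro allI impI)
  fix x y k
  assume "Option.bind (f x) (\<lambda>u. Option.bind (g x) (app u)) = Some y" and y: "y \<in> N k"
  then obtain u v where u: "f x = Some u" and v: "g x = Some v" and uv: "app u v = Some y"
    by (auto simp: bind_eq_Some_conv)
  obtain i j where ij: "u \<in> N i" "v \<in> N j"
    "\<And>a' b' c'. a' \<in> N i \<Longrightarrow> b' \<in> N j \<Longrightarrow> app a' b' = Some c' \<Longrightarrow> c' \<in> N k"
    using app_continuousE[OF uv y] by blast
  obtain i' where i': "x \<in> N i'" "\<And>x' y'. x' \<in> N i' \<Longrightarrow> f x' = Some y' \<Longrightarrow> y' \<in> N i"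
    using pcontinuousD[OF f u ij(1)] by blast
  obtain j' where j': "x \<in> N j'" "\<And>x' y'. x' \<in> N j' \<Longrightarrow> g x' = Some y' \<Longrightarrow> y' \<in> N j"
    using pcontinuousD[OF g v ij(2)] by blast
  obtain l where "x \<in> N l" "N l \<subseteq> N i' \<inter> N j'"
    using basis_inter[OF i'(1) j'(1)] by blast
  then show "\<exists>i. x \<in> N i \<and> (\<forall>x'\<in>N i. \<forall>y'.
      Option.bind (f x') (\<lambda>u. Option.bind (g x') (app u)) = Some y' \<longrightarrow> y' \<in> N k)"
    using i'(2) j'(2) ij(3) by (intro exI[of _ l]) (auto simp: bind_eq_Some_conv, blast)
qed

lemma booleans_distinct:
  assumes "booleans app t f"
  shows "t \<noteq> f"
proof
  assume "t = f"
  with assms obtain D where D: "\<And>a b. apps app D [t, a, b] = Some a \<and> apps app D [t, a, b] = Some b"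
    unfolding booleans_def by blast
  obtain x y :: 'a where "x \<noteq> y" using separated by metis
  with D[of x y] show False by (metis option.inject)
qed

text \<open>Here \<open>q\<close> is a program for the extended application that asks one query: on
  the bare argument it outputs the query tagged by \<open>c\<close>, and once an answer is appended
  it branches on that answer. It tells the two stages apart by testing whether the length minus one
  is zero.\<close>

lemma representable_case:
  assumes C: "is_coding app C"
  shows "\<exists>q. \<forall>b. app q (seq C [b]) = Some (pair C c (pair C a b)) \<and>
    app q (seq C [b, tt C]) = Some u \<and> app q (seq C [b, ff C]) = Some v"
proof -
  from C obtain D p "pred" zero len proj where D: "\<And>a b. apps app D [tt C, a, b] = Some a"
      "\<And>a b. apps app D [ff C, a, b] = Some b"
    and p: "\<And>a b. apps app p [a, b] = Some (pair C a b)"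
    and pz: "\<And>n. app pred (num C (Suc n)) = Some (num C n)"
      "app zero (num C 0) = Some (tt C)" "\<And>n. app zero (num C (Suc n)) = Some (ff C)"
    and len: "\<And>as. app len (seq C as) = Some (num C (length as))"
    and proj: "\<And>as i. i < length as \<Longrightarrow> apps app proj [num C i, seq C as] = Some (as ! i)"
    using is_codingE by metis
  \<comment> \<open>Pointwise application and constants: the functions below are applicative terms
    in the coded sequence \<open>s\<close>.\<close>
  let ?ap = "\<lambda>f g s. Option.bind (f s) (\<lambda>u. Option.bind (g s) (app u))"
  let ?c = "\<lambda>c s. Some c"
  let ?nth = "\<lambda>i. ?ap (?ap (?c proj) (?c (num C i))) Some"
  note cont = pcontinuous_app pcontinuous_const pcontinuous_id
  let ?X = "?ap (?ap (?c p) (?c c)) (?ap (?ap (?c p) (?c a)) (?nth 0))"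
  let ?Y = "?ap (?ap (?ap (?c D) (?nth 1)) (?c u)) (?c v)"
  have "pcontinuous N ?X" by (intro cont)
  then obtain X where X: "\<And>x y. ?X x = Some y \<Longrightarrow> app X x = Some y"
    using representable by blast
  have "pcontinuous N ?Y" by (intro cont)
  then obtain Y where Y: "\<And>x y. ?Y x = Some y \<Longrightarrow> app Y x = Some y"
    using representable by blast
  \<comment> \<open>\<open>X\<close> and \<open>Y\<close> are applied only after the choice between them, since \<open>?Y\<close> is
     undefined on sequences of length one.\<close>
  let ?Q = "?ap (?ap (?ap (?ap (?c D) (?ap (?c zero) (?ap (?c pred) (?ap (?c len) Some))))
    (?c X)) (?c Y)) Some"
  have "pcontinuous N ?Q" by (intro cont)
  then obtain q where q: "\<And>x y. ?Q x = Some y \<Longrightarrow> app q x = Some y"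
    using representable by blast
  let ?is1 = "\<lambda>s. ?ap (?c zero) (?ap (?c pred) (?ap (?c len) Some)) s"
  have is1: "?is1 (seq C [b]) = Some (tt C)" "?is1 (seq C [b, b']) = Some (ff C)" for b b'
    using len[of "[b]"] len[of "[b, b']"] pz by simp_all
  have nth: "?nth i (seq C as) = Some (as ! i)" if "i < length as" for i as
    using proj[OF that] by simp
  have D': "Option.bind (app D (tt C)) (\<lambda>d. Option.bind (app d a) (\<lambda>d'. app d' b)) = Some a"
    "Option.bind (app D (ff C)) (\<lambda>d. Option.bind (app d a) (\<lambda>d'. app d' b)) = Some b" for a b
    using D[of a b] by simp_all
  have p': "Option.bind (app p a) (\<lambda>d. app d b) = Some (pair C a b)" for a b
    using p[of a b] by simp
  have X1: "app X (seq C [b]) = Some (pair C c (pair C a b))" for b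
    by (rule X) (use nth[of 0 "[b]"] p' in simp)
  have Y1: "app Y (seq C [b, tt C]) = Some u" "app Y (seq C [b, ff C]) = Some v" for b
    by (rule Y; use nth[of 1 "[b, _]"] D' in simp)+
  have "app q (seq C [b]) = Some (pair C c (pair C a b))" for b
    by (rule q) (use is1[of b] X1 D' in simp)
  moreover have "app q (seq C [b, tt C]) = Some u" "app q (seq C [b, ff C]) = Some v" for b
    by (rule q; use is1 Y1 D' in simp)+
  ultimately show ?thesis by blast
qed

end

section \<open>Equality tests in the extended pca\<close>

lemma pair_eq_iff:
  assumes "is_coding app C"
  shows "pair C a b = pair C a' b' \<longleftrightarrow> a = a' \<and> b = b'"
  using assms unfolding is_coding_def by (metis option.inject)

text \<open>Two runs ask the same queries: equal answers so far give equal outputs of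
  \<open>a\<close>, hence the same next query and, \<open>f\<close> being a function, the same next
  answer. If one run were shorter, a single output would be tagged both \<open>tt C\<close> and
  \<open>ff C\<close>.\<close>

lemma computes_unique:
  assumes C: "is_coding app C" and ne: "tt C \<noteq> ff C"
    and "computes app C f a b c" "computes app C f a b c'"
  shows "c = c'"
proof -
  note pi = pair_eq_iff[OF C]
  obtain es vs where e: "length vs = length es" "\<And>i. i < length es \<Longrightarrow> f (es ! i) = Some (vs ! i)"
     "\<And>i. i < length es \<Longrightarrow> app a (seq C (b # take i vs)) = Some (pair C (ff C) (es ! i))"
     "app a (seq C (b # vs)) = Some (pair C (tt C) c)"
    using assms(3) unfolding computes_def by blast
  obtain es' vs' where e': "length vs' = length es'" "\<And>i. i < length es' \<Longrightarrow> f (es' ! i) = Some (vs' ! i)"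
     "\<And>i. i < length es' \<Longrightarrow> app a (seq C (b # take i vs')) = Some (pair C (ff C) (es' ! i))"
     "app a (seq C (b # vs')) = Some (pair C (tt C) c')"
    using assms(4) unfolding computes_def by blast
  have agree: "take i vs = take i vs'" if "i \<le> length es" "i \<le> length es'" for i
    using that
  proof (induction i)
    case (Suc i)
    then have eq: "take i vs = take i vs'" and i: "i < length es" "i < length es'" by auto
    have "es ! i = es' ! i" using e(3)[OF i(1)] e'(3)[OF i(2)] eq pi by simp
    then have "vs ! i = vs' ! i" using e(2)[OF i(1)] e'(2)[OF i(2)] by simp
    then show ?case using eq i e(1) e'(1) by (simp add: take_Suc_conv_app_nth)
  qed simp
  consider "length es < length es'" | "length es' < length es" | "length es = length es'"
    by linarith
  then show ?thesis
  proof cases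
    case 1
    then have "take (length es) vs' = vs" using agree[of "length es"] e(1) by simp
    then show ?thesis using e(4) e'(3)[OF 1] pi ne by simp
  next
    case 2
    then have "take (length es') vs = vs'" using agree[of "length es'"] e'(1) by simp
    then show ?thesis using e'(4) e(3)[OF 2] pi ne by simp
  next
    case 3
    then have "vs = vs'" using agree[of "length es"] e(1) e'(1) by simp
    then show ?thesis using e(4) e'(4) pi by simp
  qed
qed

lemma adjoin_eq_SomeI:
  assumes "is_coding app C" "tt C \<noteq> ff C" "computes app C f a b c"
  shows "adjoin app C f a b = Some c"
proof -
  have "(THE c. computes app C f a b c) = c"
    using assms computes_unique by (metis the_equality)
  then show ?thesis using assms(3) unfolding adjoin_def by auto
qed

lemma Eq_fun_pair:
  assumes "is_coding app C"
  shows "Eq_fun C (pair C a b) = Some (if a = b then tt C else ff C)"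
  using pair_eq_iff[OF assms] unfolding Eq_fun_def by auto

context continuous_papp
begin

text \<open>The one-query program asks \<open>Eq_fun\<close> about \<open>pair C a b\<close>. The
  results \<open>t\<close> and \<open>f\<close> are arbitrary because the booleans of the extended
  pca may differ from \<open>tt C\<close> and \<open>ff C\<close>.\<close>

lemma equality_test:
  assumes C: "is_coding app C"
  shows "\<exists>q. \<forall>b. adjoin_Eq app C q b = Some (if a = b then t else f)"
proof -
  have ne: "tt C \<noteq> ff C" using C booleans_distinct unfolding is_coding_def by blast
  obtain q where q: "\<And>b. app q (seq C [b]) = Some (pair C (ff C) (pair C a b))"
      "\<And>b. app q (seq C [b, tt C]) = Some (pair C (tt C) t)"
      "\<And>b. app q (seq C [b, ff C]) = Some (pair C (tt C) f)"
    using representable_case[OF C] by metis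
  have "computes app C (Eq_fun C) q b (if a = b then t else f)" for b
    unfolding computes_def
    by (rule exI[of _ "[pair C a b]"], rule exI[of _ "[if a = b then tt C else ff C]"])
      (auto simp: Eq_fun_pair[OF C] q)
  then show ?thesis
    unfolding adjoin_Eq_def using adjoin_eq_SomeI[OF C ne] by blast
qed

section \<open>Equality tests force countability\<close>

text \<open>When this is applied, \<open>'c\<close> is the underlying set of the source,
  \<open>Y a\<close> realizes the equality test for \<open>a\<close>, and \<open>X b\<close>
  realizes \<open>b\<close>. Each \<open>a\<close> receives a pair of basis indices that identifies
  it.\<close>

lemma countable_if_equality_test:
  fixes X Y :: "'c \<Rightarrow> 'a"
  assumes bool: "booleans app t f"
    and test: "\<And>a b. \<exists>z. apps app r [Y a, X b] = Some z \<and> app d z = Some (if a = b then t else f)"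
  shows "countable (UNIV :: 'c set)"
proof -
  obtain D where D: "\<And>a b. apps app D [t, a, b] = Some a" "\<And>a b. apps app D [f, a, b] = Some b"
    using bool unfolding booleans_def by blast
  obtain x y k where k: "x \<in> N k" "y \<notin> N k" using separated by blast
  \<comment> \<open>The basis need not contain an open set separating \<open>t\<close> from \<open>f\<close> in this order, so the
     booleans are first sent to \<open>x\<close> and \<open>y\<close>.\<close>
  let ?ap = "\<lambda>f g s. Option.bind (f s) (\<lambda>u. Option.bind (g s) (app u))"
  let ?c = "\<lambda>c s. Some c"
  let ?h = "?ap (?ap (?ap (?c D) (?ap (?c d) Some)) (?c x)) (?c y)"
  have cont: "pcontinuous N ?h"
    by (intro pcontinuous_app pcontinuous_const pcontinuous_id)
  have h: "\<exists>p z. app r (Y a) = Some p \<and> app p (X b) = Some z \<and> ?h z = Some (if a = b then x else y)"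
    for a b using test[of a b] D by (auto simp: bind_eq_Some_conv bind_assoc)
  have "\<exists>i j. Y a \<in> N i \<and> X a \<in> N j \<and> (\<forall>b c. Y b \<in> N i \<longrightarrow> X c \<in> N j \<longrightarrow> b = c)" for a
  proof -
    obtain p z where p: "app r (Y a) = Some p" and z: "app p (X a) = Some z"
      and hz: "?h z = Some x" using h[of a a] by auto
    \<comment> \<open>The set \<open>N k\<close> is pulled back through \<open>?h\<close>, then
      through the application of \<open>p\<close> to \<open>X a\<close>, then through that of
      \<open>r\<close> to \<open>Y a\<close>.\<close>
    obtain l where l: "z \<in> N l" "\<And>x' y'. x' \<in> N l \<Longrightarrow> ?h x' = Some y' \<Longrightarrow> y' \<in> N k"
      using pcontinuousD[OF cont hz k(1)] by blast
    obtain l' j where l': "p \<in> N l'" "X a \<in> N j"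
      "\<And>a' b' c'. a' \<in> N l' \<Longrightarrow> b' \<in> N j \<Longrightarrow> app a' b' = Some c' \<Longrightarrow> c' \<in> N l"
      using app_continuousE[OF z l(1)] by blast
    obtain m i where i: "r \<in> N m" "Y a \<in> N i"
      "\<And>a' b' c'. a' \<in> N m \<Longrightarrow> b' \<in> N i \<Longrightarrow> app a' b' = Some c' \<Longrightarrow> c' \<in> N l'"
      using app_continuousE[OF p l'(1)] by blast
    have "b = c" if bc: "Y b \<in> N i" "X c \<in> N j" for b c
    proof (rule ccontr)
      assume "b \<noteq> c"
      then obtain p' z' where "app r (Y b) = Some p'" "app p' (X c) = Some z'"
        "?h z' = Some y" using h[of b c] by auto
      with i l' l bc k(2) show False by metis
    qed
    with i(2) l'(2) show ?thesis by blast
  qed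
  then obtain I J where IJ: "\<And>a. Y a \<in> N (I a)" "\<And>a. X a \<in> N (J a)"
    "\<And>a b c. Y b \<in> N (I a) \<Longrightarrow> X c \<in> N (J a) \<Longrightarrow> b = c"
    by metis
  \<comment> \<open>If \<open>a\<close> and \<open>b\<close> have the same indices, then
    \<open>Y a\<close> and \<open>X b\<close> lie in the two neighbourhoods chosen for
    \<open>a\<close>, so \<open>a = b\<close>.\<close>
  have "inj (\<lambda>a. (I a, J a))"
    by (rule injI) (metis IJ prod.inject)
  then show ?thesis
    by (metis countableI_type countable_image_inj_on)
qed

end

lemma no_decidable_morphism:
  assumes A: "continuous_papp appA NA" and B: "continuous_papp appB NB"
    and C: "is_coding appA C" and C': "is_coding appB C'"
    and unc: "uncountable (UNIV :: 'a set)"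
  shows "\<nexists>\<gamma>. decidable_applicative_morphism
    (adjoin_Eq appA (C :: 'a coding)) (t, f) appB (tt C', ff C') \<gamma>"
proof (rule notI, elim exE)
  interpret A: continuous_papp appA NA by (rule A)
  interpret B: continuous_papp appB NB by (rule B)
  fix \<gamma> assume "decidable_applicative_morphism (adjoin_Eq appA C) (t, f) appB (tt C', ff C') \<gamma>"
  then have morph: "applicative_morphism (adjoin_Eq appA C) appB \<gamma>"
    and dec: "decidable_morphism (t, f) appB (tt C', ff C') \<gamma>"
    unfolding decidable_applicative_morphism_def by simp_all
  have ne: "\<gamma> a \<noteq> {}" for a using morph unfolding applicative_morphism_def by simp
  obtain r where r: "\<forall>a a' c. adjoin_Eq appA C a a' = Some c \<longrightarrow>
      (\<forall>b \<in> \<gamma> a. \<forall>b' \<in> \<gamma> a'. \<exists>z. apps appB r [b, b'] = Some z \<and> z \<in> \<gamma> c)"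
    using morph unfolding applicative_morphism_def by (elim conjE exE)
  obtain d where d: "\<And>b. b \<in> \<gamma> t \<Longrightarrow> appB d b = Some (tt C')"
      "\<And>b. b \<in> \<gamma> f \<Longrightarrow> appB d b = Some (ff C')"
    using dec unfolding decidable_morphism_def by auto
  have "\<forall>a. \<exists>q. \<forall>b. adjoin_Eq appA C q b = Some (if a = b then t else f)"
    using A.equality_test[OF C] by (rule allI)
  from choice[OF this] obtain q
    where q: "\<forall>a b. adjoin_Eq appA C (q a) b = Some (if a = b then t else f)" ..
  \<comment> \<open>One choice of realizers serves both families: \<open>X (q a)\<close> for the
    tests and \<open>X b\<close> for their arguments.\<close>
  define X where "X a = (SOME b. b \<in> \<gamma> a)" for a
  have X: "X a \<in> \<gamma> a" for a unfolding X_def using ne some_in_eq by blast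
  have "\<exists>z. apps appB r [X (q a), X b] = Some z \<and>
      appB d z = Some (if a = b then tt C' else ff C')" for a b
  proof -
    obtain z where "apps appB r [X (q a), X b] = Some z" "z \<in> \<gamma> (if a = b then t else f)"
      using r[rule_format, OF q[rule_format] X X] by blast
    then show ?thesis using d by (auto split: if_splits)
  qed
  moreover have "booleans appB (tt C') (ff C')" using C' unfolding is_coding_def by blast
  ultimately have "countable (UNIV :: 'a set)"
    using B.countable_if_equality_test[of _ _ r "\<lambda>a. X (q a)" X d] by blast
  with unc show False by blast
qed

section \<open>The graph model\<close>

text \<open>A basic open set consists of the supersets of a finite set, so this is the Scott
  topology. Application is continuous because finitely many output numbers use finitely many
  elements of each argument; a continuous \<open>f\<close> is represented by its graph on finite
  sets.\<close>

lemma continuous_graph_app: "continuous_papp graph_app (\<lambda>m. {B. set_decode m \<subseteq> B})"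
proof
  show "\<exists>i. x \<in> {B. set_decode i \<subseteq> B}" for x
    by (rule exI[of _ 0]) simp
  show "\<exists>k. x \<in> {B. set_decode k \<subseteq> B} \<and> {B. set_decode k \<subseteq> B} \<subseteq> {B. set_decode i \<subseteq> B} \<inter> {B. set_decode j \<subseteq> B}"
    if "x \<in> {B. set_decode i \<subseteq> B}" "x \<in> {B. set_decode j \<subseteq> B}" for x i j
    using that by (intro exI[of _ "set_encode (set_decode i \<union> set_decode j)"])
      (auto simp: set_encode_inverse)
  show "\<exists>x y k. x \<in> {B. set_decode k \<subseteq> B} \<and> y \<notin> {B. set_decode k \<subseteq> B}"
    by (rule exI[of _ UNIV], rule exI[of _ "{}"], rule exI[of _ "set_encode {0}"])
      (simp add: set_encode_inverse del: set_encode_insert)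
next
  fix A B E :: "nat set" and k
  assume E: "graph_app A B = Some E" and "E \<in> {B. set_decode k \<subseteq> B}"
  then have "\<forall>n \<in> set_decode k. \<exists>m. prod_encode (m, n) \<in> A \<and> set_decode m \<subseteq> B"
    unfolding graph_app_def by auto
  then obtain m where m: "\<And>n. n \<in> set_decode k \<Longrightarrow> prod_encode (m n, n) \<in> A \<and> set_decode (m n) \<subseteq> B"
    by metis
  \<comment> \<open>For each \<open>n\<close> in the finite target, \<open>?i\<close> keeps one
    element of \<open>A\<close> that yields it, and \<open>?j\<close> keeps the finite part of
    \<open>B\<close> that this element consults.\<close>
  let ?i = "set_encode ((\<lambda>n. prod_encode (m n, n)) ` set_decode k)"
  let ?j = "set_encode (\<Union>n \<in> set_decode k. set_decode (m n))"
  show "\<exists>i j. A \<in> {B. set_decode i \<subseteq> B} \<and> B \<in> {B. set_decode j \<subseteq> B} \<and>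
      (\<forall>a'\<in>{B. set_decode i \<subseteq> B}. \<forall>b'\<in>{B. set_decode j \<subseteq> B}. \<forall>c'.
         graph_app a' b' = Some c' \<longrightarrow> c' \<in> {B. set_decode k \<subseteq> B})"
    by (rule exI[of _ ?i], rule exI[of _ ?j]) (use m in \<open>fastforce simp: set_encode_inverse graph_app_def\<close>)
next
  fix f :: "nat set \<Rightarrow> nat set option"
  assume f: "pcontinuous (\<lambda>m. {B. set_decode m \<subseteq> B}) f"
  \<comment> \<open>A pair enters when every value of \<open>f\<close> above the finite set coded by
    \<open>m\<close> contains \<open>n\<close>. If \<open>f\<close> has no value above that set,
    this holds vacuously, but then the set is contained in no \<open>x\<close> of the
    domain.\<close>
  let ?e = "{prod_encode (m, n) | m n. \<forall>x y. set_decode m \<subseteq> x \<longrightarrow> f x = Some y \<longrightarrow> n \<in> y}"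
  have "graph_app ?e x = Some y" if xy: "f x = Some y" for x y
  proof -
    have m: "\<exists>m. set_decode m \<subseteq> x \<and> (\<forall>x' y'. set_decode m \<subseteq> x' \<longrightarrow> f x' = Some y' \<longrightarrow> n \<in> y')"
      if "n \<in> y" for n
    proof -
      have "y \<in> {B. set_decode (set_encode {n}) \<subseteq> B}"
        using that by (simp add: set_encode_inverse del: set_encode_insert)
      from pcontinuousD[OF f xy this] show ?thesis
        by (metis (no_types, lifting) finite.emptyI finite.insertI insert_subset mem_Collect_eq set_encode_inverse)
    qed
    have "n \<in> y \<longleftrightarrow> (\<exists>m. prod_encode (m, n) \<in> ?e \<and> set_decode m \<subseteq> x)" for n
    proof
      assume "n \<in> y"
      then obtain m where "set_decode m \<subseteq> x"
        "\<And>x' y'. set_decode m \<subseteq> x' \<Longrightarrow> f x' = Some y' \<Longrightarrow> n \<in> y'" using m by metis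
      then show "\<exists>m. prod_encode (m, n) \<in> ?e \<and> set_decode m \<subseteq> x" by blast
    next
      assume "\<exists>m. prod_encode (m, n) \<in> ?e \<and> set_decode m \<subseteq> x"
      then obtain m m' n' where "prod_encode (m, n) = prod_encode (m', n')" "set_decode m \<subseteq> x"
        "\<And>x' y'. set_decode m' \<subseteq> x' \<Longrightarrow> f x' = Some y' \<Longrightarrow> n' \<in> y'" by blast
      then show "n \<in> y" using xy by simp
    qed
    then show ?thesis unfolding graph_app_def by blast
  qed
  then show "\<exists>e. \<forall>x y. f x = Some y \<longrightarrow> graph_app e x = Some y" by blast
qed

section \<open>Sequence spaces\<close>

text \<open>The base of the product topology with discrete factors. Indexing by lists keeps it
  countable for countable \<open>'c\<close>.\<close>

definition cylinder :: "'c list \<Rightarrow> (nat \<Rightarrow> 'c) set" where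
  "cylinder \<sigma> = {\<beta>. \<forall>i<length \<sigma>. \<beta> i = \<sigma> ! i}"

lemma mem_cylinder_iff: "\<beta> \<in> cylinder \<sigma> \<longleftrightarrow> (\<forall>i<length \<sigma>. \<beta> i = \<sigma> ! i)"
  unfolding cylinder_def by blast

lemma mem_cylinder_map: "\<beta>' \<in> cylinder (map \<beta> [0..<k]) \<longleftrightarrow> (\<forall>i<k. \<beta>' i = \<beta> i)"
  unfolding cylinder_def by simp

lemma uncountable_sequences:
  assumes "(a :: 'c) \<noteq> b"
  shows "uncountable (UNIV :: (nat \<Rightarrow> 'c) set)"
proof
  assume "countable (UNIV :: (nat \<Rightarrow> 'c) set)"
  then obtain e :: "nat \<Rightarrow> nat \<Rightarrow> 'c" where "range e = UNIV"
    using range_from_nat_into by blast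
  \<comment> \<open>The diagonal sequence differs from \<open>e i\<close> at position
    \<open>i\<close>.\<close>
  then obtain n where "e n = (\<lambda>i. if e i i = a then b else a)" by (metis surjD)
  then have "e n n = (if e n n = a then b else a)" by metis
  with assms show False by (metis (full_types))
qed

text \<open>Continuity for cylinders amounts to each output coordinate depending on finite prefixes
  of the inputs. A sequence model then has to supply only a modulus \<open>m\<close> for each
  coordinate and a code for each such \<open>f\<close>.\<close>

lemma continuous_papp_sequences:
  fixes app :: "(nat \<Rightarrow> 'c::countable) papp"
  assumes ne: "(x :: 'c) \<noteq> y"
    and local: "\<And>\<alpha> \<beta> \<gamma> n. app \<alpha> \<beta> = Some \<gamma> \<Longrightarrow> \<exists>m. \<forall>\<alpha>' \<beta>' \<gamma>'.
      (\<forall>i<m. \<alpha>' i = \<alpha> i) \<longrightarrow> (\<forall>i<m. \<beta>' i = \<beta> i) \<longrightarrow> app \<alpha>' \<beta>' = Some \<gamma>' \<longrightarrow> \<gamma>' n = \<gamma> n"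
    and repr: "\<And>f. (\<And>\<beta> \<gamma> n. f \<beta> = Some \<gamma> \<Longrightarrow> \<exists>m. \<forall>\<beta>' \<gamma>'. (\<forall>i<m. \<beta>' i = \<beta> i) \<longrightarrow>
      f \<beta>' = Some \<gamma>' \<longrightarrow> \<gamma>' n = \<gamma> n) \<Longrightarrow> \<exists>\<alpha>. \<forall>\<beta> \<gamma>. f \<beta> = Some \<gamma> \<longrightarrow> app \<alpha> \<beta> = Some \<gamma>"
  shows "continuous_papp app cylinder"
proof
  show "\<exists>i. \<beta> \<in> cylinder i" for \<beta> :: "nat \<Rightarrow> 'c"
    by (rule exI[of _ "[]"]) (simp add: cylinder_def)
  show "\<exists>k. \<beta> \<in> cylinder k \<and> cylinder k \<subseteq> cylinder \<sigma> \<inter> cylinder \<tau>"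
    if "\<beta> \<in> cylinder \<sigma>" "\<beta> \<in> cylinder \<tau>" for \<beta> :: "nat \<Rightarrow> 'c" and \<sigma> \<tau>
  proof (rule exI, intro conjI subsetI IntI)
    let ?k = "map \<beta> [0..<max (length \<sigma>) (length \<tau>)]"
    show "\<beta> \<in> cylinder ?k" by (simp add: mem_cylinder_map)
    fix \<beta>' assume "\<beta>' \<in> cylinder ?k"
    then show "\<beta>' \<in> cylinder \<sigma>" "\<beta>' \<in> cylinder \<tau>"
      using that unfolding mem_cylinder_map unfolding mem_cylinder_iff by auto
  qed
  have "(\<lambda>_. x) \<in> cylinder [x]" "(\<lambda>_. y) \<notin> cylinder [x]"
    using ne unfolding cylinder_def by auto
  then show "\<exists>\<alpha> \<beta> \<sigma>. \<alpha> \<in> cylinder \<sigma> \<and> \<beta> \<notin> (cylinder \<sigma> :: (nat \<Rightarrow> 'c) set)"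
    by blast
next
  fix \<alpha> \<beta> \<gamma> :: "nat \<Rightarrow> 'c" and \<sigma> assume app: "app \<alpha> \<beta> = Some \<gamma>" and \<gamma>: "\<gamma> \<in> cylinder \<sigma>"
  have "\<forall>n. \<exists>m. \<forall>\<alpha>' \<beta>' \<gamma>'. (\<forall>i<m. \<alpha>' i = \<alpha> i) \<longrightarrow> (\<forall>i<m. \<beta>' i = \<beta> i) \<longrightarrow>
      app \<alpha>' \<beta>' = Some \<gamma>' \<longrightarrow> \<gamma>' n = \<gamma> n"
    using local[OF app] by (rule allI)
  from choice[OF this] obtain m where m: "\<And>n \<alpha>' \<beta>' \<gamma>'. (\<forall>i<m n. \<alpha>' i = \<alpha> i) \<Longrightarrow>
      (\<forall>i<m n. \<beta>' i = \<beta> i) \<Longrightarrow> app \<alpha>' \<beta>' = Some \<gamma>' \<Longrightarrow> \<gamma>' n = \<gamma> n"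
    by blast
  \<comment> \<open>The maximum turns the moduli of single coordinates into one that serves all
    coordinates fixed by \<open>\<sigma>\<close>.\<close>
  define M where "M = Max (m ` {..length \<sigma>})"
  have M: "m n \<le> M" if "n < length \<sigma>" for n
    using that unfolding M_def by (intro Max_ge) auto
  have nbhd: "\<gamma>' \<in> cylinder \<sigma>" if "\<alpha>' \<in> cylinder (map \<alpha> [0..<M])" "\<beta>' \<in> cylinder (map \<beta> [0..<M])"
    "app \<alpha>' \<beta>' = Some \<gamma>'" for \<alpha>' \<beta>' \<gamma>'
    unfolding mem_cylinder_iff
  proof (intro allI impI)
    fix n assume n: "n < length \<sigma>"
    have "\<gamma>' n = \<gamma> n"
      using that(1,2) M[OF n] by (intro m[OF _ _ that(3)]) (auto simp: mem_cylinder_map)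
    then show "\<gamma>' n = \<sigma> ! n" using \<gamma> n by (simp add: mem_cylinder_iff)
  qed
  show "\<exists>i j. \<alpha> \<in> cylinder i \<and> \<beta> \<in> cylinder j \<and> (\<forall>\<alpha>'\<in>cylinder i. \<forall>\<beta>'\<in>cylinder j.
      \<forall>\<gamma>'. app \<alpha>' \<beta>' = Some \<gamma>' \<longrightarrow> \<gamma>' \<in> cylinder \<sigma>)"
    by (rule exI[of _ "map \<alpha> [0..<M]"], rule exI[of _ "map \<beta> [0..<M]"])
      (use nbhd in \<open>auto simp: mem_cylinder_map\<close>)
next
  fix f :: "(nat \<Rightarrow> 'c) \<Rightarrow> (nat \<Rightarrow> 'c) option" assume f: "pcontinuous cylinder f"
  show "\<exists>e. \<forall>x y. f x = Some y \<longrightarrow> app e x = Some y"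
  proof (rule repr)
    fix \<beta> \<gamma> n assume \<beta>: "f \<beta> = Some \<gamma>"
    \<comment> \<open>Length \<open>Suc n\<close> is the shortest prefix that includes coordinate
      \<open>n\<close>.\<close>
    have "\<gamma> \<in> cylinder (map \<gamma> [0..<Suc n])" unfolding mem_cylinder_map by simp
    from pcontinuousD[OF f \<beta> this] obtain \<sigma> where \<sigma>: "\<beta> \<in> cylinder \<sigma>"
      "\<And>\<beta>' \<gamma>'. \<beta>' \<in> cylinder \<sigma> \<Longrightarrow> f \<beta>' = Some \<gamma>' \<Longrightarrow> \<gamma>' \<in> cylinder (map \<gamma> [0..<Suc n])" by blast
    then show "\<exists>m. \<forall>\<beta>' \<gamma>'. (\<forall>i<m. \<beta>' i = \<beta> i) \<longrightarrow> f \<beta>' = Some \<gamma>' \<longrightarrow> \<gamma>' n = \<gamma> n"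
      by (intro exI[of _ "length \<sigma>"]) (metis lessI mem_cylinder_iff mem_cylinder_map)
  qed
qed

section \<open>Output coordinates forced by a finite prefix\<close>

text \<open>The first conjunct makes \<open>v\<close> unique: if no point of the domain extends
  \<open>\<sigma>\<close>, the second conjunct holds for every \<open>v\<close>.\<close>

definition determined :: "((nat \<Rightarrow> 'c) \<Rightarrow> (nat \<Rightarrow> 'd) option) \<Rightarrow> nat \<Rightarrow> 'c list \<Rightarrow> 'd \<Rightarrow> bool" where
  "determined f n \<sigma> v \<longleftrightarrow> (\<exists>\<beta> \<in> cylinder \<sigma>. f \<beta> \<noteq> None) \<and>
     (\<forall>\<beta> \<in> cylinder \<sigma>. \<forall>\<gamma>. f \<beta> = Some \<gamma> \<longrightarrow> \<gamma> n = v)"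

lemma determinedD:
  assumes "determined f n (map \<beta> [0..<k]) v" "f \<beta> = Some \<gamma>"
  shows "v = \<gamma> n"
  using assms unfolding determined_def by (auto simp: mem_cylinder_map)

text \<open>The longer prefix has a smaller cylinder, which still meets the domain of
  \<open>f\<close> because it contains \<open>\<beta>\<close>.\<close>

lemma determined_mono:
  assumes "determined f n (map \<beta> [0..<k]) v" "f \<beta> = Some \<gamma>" "k \<le> l"
  shows "determined f n (map \<beta> [0..<l]) v"
  using assms unfolding determined_def by (auto simp: mem_cylinder_map)

lemma determined_exists:
  assumes "\<exists>m. \<forall>\<beta>' \<gamma>'. (\<forall>i<m. \<beta>' i = \<beta> i) \<longrightarrow> f \<beta>' = Some \<gamma>' \<longrightarrow> \<gamma>' n = \<gamma> n" "f \<beta> = Some \<gamma>"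
  shows "\<exists>k. determined f n (map \<beta> [0..<k]) (\<gamma> n)"
proof -
  obtain m where m: "\<forall>\<beta>' \<gamma>'. (\<forall>i<m. \<beta>' i = \<beta> i) \<longrightarrow> f \<beta>' = Some \<gamma>' \<longrightarrow> \<gamma>' n = \<gamma> n"
    using assms(1) by (elim exE)
  have "\<beta> \<in> cylinder (map \<beta> [0..<m])" unfolding mem_cylinder_map by simp
  then have "\<exists>\<beta>' \<in> cylinder (map \<beta> [0..<m]). f \<beta>' \<noteq> None" using assms(2) by (intro bexI[of _ \<beta>]) simp_all
  moreover have "\<gamma>' n = \<gamma> n" if "\<beta>' \<in> cylinder (map \<beta> [0..<m])" "f \<beta>' = Some \<gamma>'" for \<beta>' \<gamma>'
    using m that unfolding mem_cylinder_map by simp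
  ultimately have "determined f n (map \<beta> [0..<m]) (\<gamma> n)"
    unfolding determined_def by simp
  then show ?thesis ..
qed

section \<open>The two function models\<close>

lemma query_cong: "(\<And>i. i < k \<Longrightarrow> \<beta>' i = \<beta> i) \<Longrightarrow> query n \<beta>' k = query n \<beta> k"
  unfolding query_def by (auto intro!: arg_cong[of _ _ list_encode])

text \<open>Locality of an unbounded search: agreement up to one witness already fixes where the
  search stops.\<close>

lemma Least_cong_le:
  assumes "P (k :: nat)" "\<And>j. j \<le> k \<Longrightarrow> P j = Q j"
  shows "(LEAST j. P j) = (LEAST j. Q j)"
proof -
  have l: "(LEAST j. P j) \<le> k" "P (LEAST j. P j)" using assms(1) by (auto intro: Least_le LeastI)
  show ?thesis
    by (rule Least_equality[symmetric])
      (use l assms(2) in auto, metis Least_le assms(2) le_trans linear)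
qed

section \<open>Kleene's second model\<close>

lemma continuous_K2_app: "continuous_papp K2_app cylinder"
proof (rule continuous_papp_sequences)
  show "(0::nat) \<noteq> 1" by simp
next
  fix \<alpha> \<beta> \<gamma> n assume app: "K2_app \<alpha> \<beta> = Some \<gamma>"
  let ?P = "\<lambda>k. \<alpha> (query n \<beta> k) > 0"
  define k where "k = (LEAST k. ?P k)"
  have "\<exists>k. ?P k" using app unfolding K2_app_def by (metis option.distinct(1))
  then have k: "?P k" unfolding k_def by (rule LeastI_ex)
  have \<gamma>: "\<gamma> n = \<alpha> (query n \<beta> k) - 1" using app unfolding K2_app_def k_def by (auto split: if_splits)
  \<comment> \<open>The modulus covers the first \<open>k\<close> entries of \<open>\<beta>\<close>
    and the codes of its prefixes of length up to \<open>k\<close>, which are the positions where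
    \<open>\<alpha>\<close> is read.\<close>
  let ?m = "Suc (k + Max (query n \<beta> ` {..k}))"
  have "\<gamma>' n = \<gamma> n" if \<alpha>: "\<forall>i<?m. \<alpha>' i = \<alpha> i" and \<beta>: "\<forall>i<?m. \<beta>' i = \<beta> i"
    and app': "K2_app \<alpha>' \<beta>' = Some \<gamma>'" for \<alpha>' \<beta>' \<gamma>'
  proof -
    have q: "query n \<beta>' j = query n \<beta> j" if "j \<le> k" for j
      using that \<beta> by (intro query_cong) auto
    have eq: "\<alpha>' (query n \<beta>' j) = \<alpha> (query n \<beta> j)" if "j \<le> k" for j
    proof -
      have "query n \<beta> j \<le> Max (query n \<beta> ` {..k})" using that by (intro Max_ge) auto
      then show ?thesis using \<alpha> q[OF that] by simp
    qed
    have "k = (LEAST k. \<alpha>' (query n \<beta>' k) > 0)"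
      unfolding k_def by (rule Least_cong_le[where P = ?P, OF k]) (simp add: eq)
    then show ?thesis using app' eq[of k] \<gamma> unfolding K2_app_def by (auto split: if_splits)
  qed
  then show "\<exists>m. \<forall>\<alpha>' \<beta>' \<gamma>'. (\<forall>i<m. \<alpha>' i = \<alpha> i) \<longrightarrow> (\<forall>i<m. \<beta>' i = \<beta> i) \<longrightarrow>
      K2_app \<alpha>' \<beta>' = Some \<gamma>' \<longrightarrow> \<gamma>' n = \<gamma> n" by blast
next
  fix f :: "(nat \<Rightarrow> nat) \<Rightarrow> (nat \<Rightarrow> nat) option"
  assume f: "\<And>\<beta> \<gamma> n. f \<beta> = Some \<gamma> \<Longrightarrow> \<exists>m. \<forall>\<beta>' \<gamma>'. (\<forall>i<m. \<beta>' i = \<beta> i) \<longrightarrow>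
      f \<beta>' = Some \<gamma>' \<longrightarrow> \<gamma>' n = \<gamma> n"
  \<comment> \<open>The head of the decoded list is the output coordinate, the tail a prefix of the
    argument. The shift by \<open>Suc\<close> leaves \<open>0\<close> free to mean that the prefix
    does not yet force a value.\<close>
  define \<alpha> where "\<alpha> c = (let l = list_decode c; n = hd l; \<sigma> = tl l in
     if \<exists>v. determined f n \<sigma> v then Suc (SOME v. determined f n \<sigma> v) else 0)" for c
  have \<alpha>: "\<alpha> (query n \<beta> k) = (if \<exists>v. determined f n (map \<beta> [0..<k]) v
      then Suc (SOME v. determined f n (map \<beta> [0..<k]) v) else 0)" for n \<beta> k
    unfolding \<alpha>_def query_def by (simp add: Let_def)
  have "K2_app \<alpha> \<beta> = Some \<gamma>" if \<beta>: "f \<beta> = Some \<gamma>" for \<beta> \<gamma>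
  proof -
    \<comment> \<open>On an argument in the domain a determined value must be the actual one, so
      \<open>SOME\<close> picks \<open>\<gamma> n\<close>.\<close>
    have val: "\<alpha> (query n \<beta> k) = Suc (\<gamma> n)" if "\<alpha> (query n \<beta> k) > 0" for n k
    proof -
      have det: "\<exists>v. determined f n (map \<beta> [0..<k]) v"
        by (rule ccontr) (use that \<alpha> in simp)
      from determinedD[OF someI_ex[OF this] \<beta>] show ?thesis unfolding \<alpha> using det by simp
    qed
    have ex: "\<exists>k. \<alpha> (query n \<beta> k) > 0" for n
      using determined_exists[OF f[OF \<beta>, of n] \<beta>] unfolding \<alpha> by fastforce
    then have "\<alpha> (query n \<beta> (LEAST k. \<alpha> (query n \<beta> k) > 0)) = Suc (\<gamma> n)" for n
      using val LeastI_ex[OF ex] by blast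
    then show ?thesis using ex unfolding K2_app_def by simp
  qed
  then show "\<exists>\<alpha>. \<forall>\<beta> \<gamma>. f \<beta> = Some \<gamma> \<longrightarrow> K2_app \<alpha> \<beta> = Some \<gamma>" by blast
qed

section \<open>The model on binary sequences\<close>

lemma continuous_cantor_app: "continuous_papp cantor_app cylinder"
proof (rule continuous_papp_sequences)
  show "True \<noteq> False" by simp
next
  fix \<alpha> \<beta> \<gamma> n assume app: "cantor_app \<alpha> \<beta> = Some \<gamma>"
  let ?P = "\<lambda>k. \<alpha> (cantor_query n \<beta> k)"
  define k where "k = (LEAST k. ?P k)"
  have "\<exists>k. ?P k" using app unfolding cantor_app_def by (metis option.distinct(1))
  then have k: "?P k" unfolding k_def by (rule LeastI_ex)
  have \<gamma>: "\<gamma> n = \<alpha> (cantor_query n \<beta> (Suc k))"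
    using app unfolding cantor_app_def k_def by (auto split: if_splits)
  \<comment> \<open>The output bit is read at prefix length \<open>Suc k\<close>, so the modulus
    must cover that lookup too.\<close>
  let ?m = "Suc (k + Max (cantor_query n \<beta> ` {..Suc k}))"
  have "\<gamma>' n = \<gamma> n" if \<alpha>: "\<forall>i<?m. \<alpha>' i = \<alpha> i" and \<beta>: "\<forall>i<?m. \<beta>' i = \<beta> i"
    and app': "cantor_app \<alpha>' \<beta>' = Some \<gamma>'" for \<alpha>' \<beta>' \<gamma>'
  proof -
    have q: "cantor_query n \<beta>' j = cantor_query n \<beta> j" if "j \<le> Suc k" for j
      using that \<beta> unfolding cantor_query_def by (intro query_cong) auto
    have eq: "\<alpha>' (cantor_query n \<beta>' j) = \<alpha> (cantor_query n \<beta> j)" if "j \<le> Suc k" for j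
    proof -
      have "cantor_query n \<beta> j \<le> Max (cantor_query n \<beta> ` {..Suc k})"
        using that by (intro Max_ge) auto
      then show ?thesis using \<alpha> q[OF that] by simp
    qed
    have "k = (LEAST k. \<alpha>' (cantor_query n \<beta>' k))"
      unfolding k_def by (rule Least_cong_le[where P = ?P, OF k]) (simp add: eq)
    then show ?thesis using app' eq[of "Suc k"] \<gamma> unfolding cantor_app_def by (auto split: if_splits)
  qed
  then show "\<exists>m. \<forall>\<alpha>' \<beta>' \<gamma>'. (\<forall>i<m. \<alpha>' i = \<alpha> i) \<longrightarrow> (\<forall>i<m. \<beta>' i = \<beta> i) \<longrightarrow>
      cantor_app \<alpha>' \<beta>' = Some \<gamma>' \<longrightarrow> \<gamma>' n = \<gamma> n" by blast
next
  fix f :: "(nat \<Rightarrow> bool) \<Rightarrow> (nat \<Rightarrow> bool) option"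
  assume f: "\<And>\<beta> \<gamma> n. f \<beta> = Some \<gamma> \<Longrightarrow> \<exists>m. \<forall>\<beta>' \<gamma>'. (\<forall>i<m. \<beta>' i = \<beta> i) \<longrightarrow>
      f \<beta>' = Some \<gamma>' \<longrightarrow> \<gamma>' n = \<gamma> n"
  \<comment> \<open>The first \<open>1\<close> is at the shortest prefix that determines the value; the value itself is
     stored one position later, where the butlast is already determined.\<close>
  define \<alpha> where "\<alpha> c = (let l = list_decode c; n = hd l; \<sigma> = map (\<lambda>i. i = 1) (tl l) in
     if \<sigma> \<noteq> [] \<and> (\<exists>v. determined f n (butlast \<sigma>) v) then determined f n \<sigma> True
     else \<exists>v. determined f n \<sigma> v)" for c
  have \<alpha>: "\<alpha> (cantor_query n \<beta> k) = (if k \<noteq> 0 \<and> (\<exists>v. determined f n (map \<beta> [0..<k-1]) v)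
      then determined f n (map \<beta> [0..<k]) True else \<exists>v. determined f n (map \<beta> [0..<k]) v)" for n \<beta> k
  proof -
    \<comment> \<open>The bits of the argument enter a query as the numbers 0 and 1; comparison with
      1 recovers them.\<close>
    have "map (\<lambda>i. i = Suc 0) (map (\<lambda>i. of_bool (\<beta> i)) [0..<k]) = map \<beta> [0..<k]"
      by simp
    moreover have "butlast (map \<beta> [0..<k]) = map \<beta> [0..<k-1]"
      by (cases k) (simp_all add: butlast_append)
    ultimately show ?thesis
      unfolding \<alpha>_def cantor_query_def query_def list_encode_inverse Let_def list.sel
      by (simp del: map_map) blast
  qed
  have "cantor_app \<alpha> \<beta> = Some \<gamma>" if \<beta>: "f \<beta> = Some \<gamma>" for \<beta> \<gamma>
  proof -
    have "(\<exists>k. \<alpha> (cantor_query n \<beta> k)) \<and>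
      \<alpha> (cantor_query n \<beta> (Suc (LEAST k. \<alpha> (cantor_query n \<beta> k)))) = \<gamma> n" for n
    proof -
      let ?det = "\<lambda>k. \<exists>v. determined f n (map \<beta> [0..<k]) v"
      define k where "k = (LEAST k. ?det k)"
      have "\<exists>k. ?det k" using determined_exists[OF f[OF \<beta>, of n] \<beta>] by blast
      then have k: "?det k" unfolding k_def by (rule LeastI_ex)
      have less: "\<not> ?det j" if "j < k" for j using that not_less_Least unfolding k_def by blast
      \<comment> \<open>No prefix shorter than \<open>k\<close> is determined, so at all lengths up
        to \<open>k\<close> the second case of \<open>\<alpha>\<close> applies, and its first
        \<open>1\<close> is at \<open>k\<close>.\<close>
      have one: "\<alpha> (cantor_query n \<beta> k)"
        using k less[of "k - 1"] unfolding \<alpha> by auto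
      have none: "\<not> \<alpha> (cantor_query n \<beta> j)" if "j < k" for j
        using less[OF that] less[of "j - 1"] that unfolding \<alpha> by auto
      have L: "(LEAST k. \<alpha> (cantor_query n \<beta> k)) = k"
        using one none by (intro Least_equality) (auto simp: not_less[symmetric])
      have val: "v = \<gamma> n" if "determined f n (map \<beta> [0..<l]) v" for l v
        using determinedD[of f n \<beta> l v \<gamma>] that \<beta> by simp
      \<comment> \<open>Length \<open>Suc k\<close> falls under the first case, where
        \<open>\<alpha>\<close> stores whether the determined value is \<open>True\<close>; by
        uniqueness this is the bit \<open>\<gamma> n\<close>.\<close>
      have "determined f n (map \<beta> [0..<Suc k]) (\<gamma> n)"
        using k val determined_mono[of f n \<beta> k _ \<gamma> "Suc k"] \<beta> by fastforce
      then have "determined f n (map \<beta> [0..<Suc k]) True \<longleftrightarrow> \<gamma> n"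
        using val[of "Suc k" True] by (cases "\<gamma> n") auto
      then have "\<alpha> (cantor_query n \<beta> (Suc k)) = \<gamma> n" using k unfolding \<alpha> by simp
      with one L show ?thesis by auto
    qed
    then show ?thesis unfolding cantor_app_def by auto
  qed
  then show "\<exists>\<alpha>. \<forall>\<beta> \<gamma>. f \<beta> = Some \<gamma> \<longrightarrow> cantor_app \<alpha> \<beta> = Some \<gamma>" by blast
qed

section \<open>Uncountable sources and the nine combinations\<close>

lemma uncountable_nat_set: "uncountable (UNIV :: nat set set)"
proof
  assume "countable (UNIV :: nat set set)"
  then obtain e :: "nat \<Rightarrow> nat set" where "range e = UNIV"
    using range_from_nat_into by blast
  then show False using Cantors_theorem[of UNIV] by auto
qed

theorem corollary3p6:
  fixes P :: "nat set coding" and K :: "(nat \<Rightarrow> nat) coding" and C :: "(nat \<Rightarrow> bool) coding"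
    and tP fP :: "nat set" and tK fK :: "nat \<Rightarrow> nat" and tC fC :: "nat \<Rightarrow> bool"
  assumes "is_coding graph_app P"
    and "is_coding K2_app K"
    and "is_coding cantor_app C"
    and "booleans (adjoin_Eq graph_app P) tP fP"
    and "booleans (adjoin_Eq K2_app K) tK fK"
    and "booleans (adjoin_Eq cantor_app C) tC fC"
  shows
    "(\<nexists>\<gamma>. decidable_applicative_morphism
         (adjoin_Eq graph_app P) (tP, fP) graph_app (tt P, ff P) \<gamma>) \<and>
     (\<nexists>\<gamma>. decidable_applicative_morphism
         (adjoin_Eq graph_app P) (tP, fP) K2_app (tt K, ff K) \<gamma>) \<and>
     (\<nexists>\<gamma>. decidable_applicative_morphism
         (adjoin_Eq graph_app P) (tP, fP) cantor_app (tt C, ff C) \<gamma>) \<and>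
     (\<nexists>\<gamma>. decidable_applicative_morphism
         (adjoin_Eq K2_app K) (tK, fK) graph_app (tt P, ff P) \<gamma>) \<and>
     (\<nexists>\<gamma>. decidable_applicative_morphism
         (adjoin_Eq K2_app K) (tK, fK) K2_app (tt K, ff K) \<gamma>) \<and>
     (\<nexists>\<gamma>. decidable_applicative_morphism
         (adjoin_Eq K2_app K) (tK, fK) cantor_app (tt C, ff C) \<gamma>) \<and>
     (\<nexists>\<gamma>. decidable_applicative_morphism
         (adjoin_Eq cantor_app C) (tC, fC) graph_app (tt P, ff P) \<gamma>) \<and>
     (\<nexists>\<gamma>. decidable_applicative_morphism
         (adjoin_Eq cantor_app C) (tC, fC) K2_app (tt K, ff K) \<gamma>) \<and>
     (\<nexists>\<gamma>. decidable_applicative_morphism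
         (adjoin_Eq cantor_app C) (tC, fC) cantor_app (tt C, ff C) \<gamma>)"
  using assms
  \<comment> \<open>One instance for each source and target; uncountability of the source comes from
    Cantor's theorem for the power set and from the diagonal argument for the sequence
    spaces.\<close>
  by (intro conjI no_decidable_morphism[OF continuous_graph_app continuous_graph_app]
      no_decidable_morphism[OF continuous_graph_app continuous_K2_app]
      no_decidable_morphism[OF continuous_graph_app continuous_cantor_app]
      no_decidable_morphism[OF continuous_K2_app continuous_graph_app]
      no_decidable_morphism[OF continuous_K2_app continuous_K2_app]
      no_decidable_morphism[OF continuous_K2_app continuous_cantor_app]
      no_decidable_morphism[OF continuous_cantor_app continuous_graph_app]
      no_decidable_morphism[OF continuous_cantor_app continuous_K2_app]
      no_decidable_morphism[OF continuous_cantor_app continuous_cantor_app]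
      uncountable_nat_set uncountable_sequences[of "0::nat" 1]
      uncountable_sequences[of True False]) simp_all

end
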